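(* Let $\mu$ be any probability measure on $\{0,1\}^{\mathbb Z}$, let $(p,r)\in(0,1)^2$, and let $(e(i,t))_{i\in\mathbb Z,t\in\mathbb N}\sim\mathcal L(\mu;p,r)$. Denote by $\mu_t$ the law of $(e(i,t):i\in\mathbb Z)$. Then $\mu_t$ converges weakly (in law, for the product topology on $\{0,1\}^{\mathbb Z}$) to $\mathrm{PM}(1/2)$ as $t\to\infty$.
   Context: $\mathbb N=\{0,1,2,\dots\}$. $\mathrm{PM}(1/2)$ is the law on $\{0,1\}^{\mathbb Z}$ of i.i.d. Bernoulli$(1/2)$ variables indexed by $\mathbb Z$. The law $\mathcal L(\mu;p,r)$, for $\mu$ a probability measure on $\{0,1\}^{\mathbb Z}$ and $p,r\in[0,1]$, is the law of the random field $(e(i,t))_{i\in\mathbb Z,t\in\mathbb N}\in\{0,1\}^{\mathbb Z\times\mathbb N}$ such that $(e(i,0))_{i\in\mathbb Z}\sim\mu$ and $(e(\cdot,t))_{t\ge0}$ is a Markov chain such that, given line $t$, independently for all $i\in\mathbb Z$ with $i+t$ even, the pair $(e(i,t+1),e(i+1,t+1))$ depends only on $(e(i,t),e(i+1,t))$, with, for $k\in\{0,1\}$: $(k,k)\mapsto(k,k)$ with probability $r$ and $(k,k)\mapsto(1-k,1-k)$ with probability $1-r$; $(k,1-k)\mapsto(1-k,k)$ with probability $p$ and $(k,1-k)\mapsto(k,1-k)$ with probability $1-p$. *)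

theory Defs
  imports "HOL-Probability.Probability"
begin

text \<open>
  The alphabet $\{0,1\}$ is \<^typ>\<open>bool\<close> (1 is \<^term>\<open>True\<close>), so a line is a function
  \<^typ>\<open>int \<Rightarrow> bool\<close> and a space-time configuration a function \<^typ>\<open>int \<times> nat \<Rightarrow> bool\<close>.
  Both carry the product sigma-algebra.
\<close>

abbreviation line_space :: "(int \<Rightarrow> bool) measure" where
  "line_space \<equiv> PiM UNIV (\<lambda>_. count_space UNIV)"

abbreviation field_space :: "(int \<times> nat \<Rightarrow> bool) measure" where
  "field_space \<equiv> PiM UNIV (\<lambda>_. count_space UNIV)"

definition PM_half :: "(int \<Rightarrow> bool) measure" where
  "PM_half = PiM UNIV (\<lambda>_. measure_pmf (bernoulli_pmf (1 / 2)))"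

fun cell_update :: "real \<Rightarrow> real \<Rightarrow> bool \<times> bool \<Rightarrow> (bool \<times> bool) pmf" where
  "cell_update p r (a, b) =
     (if a = b
      then map_pmf (\<lambda>keep. if keep then (a, a) else (\<not> a, \<not> a)) (bernoulli_pmf r)
      else map_pmf (\<lambda>swap. if swap then (b, a) else (a, b)) (bernoulli_pmf p))"

text \<open>
  At time \<open>t\<close> the line is cut into the cells \<open>{i, i + 1}\<close> with \<open>i + t\<close> even; a cell is
  represented by its left end.
\<close>

definition cells :: "nat \<Rightarrow> int set" where
  "cells t = {i. even (i + int t)}"

definition glue_cells :: "nat \<Rightarrow> (int \<Rightarrow> bool \<times> bool) \<Rightarrow> int \<Rightarrow> bool" where
  "glue_cells t c i = (if i \<in> cells t then fst (c i) else snd (c (i - 1)))"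

text \<open>The law of line \<open>t + 1\<close> given that line \<open>t\<close> is \<open>x\<close>: independent updates of all cells.\<close>

definition step_kernel :: "real \<Rightarrow> real \<Rightarrow> nat \<Rightarrow> (int \<Rightarrow> bool) \<Rightarrow> (int \<Rightarrow> bool) measure" where
  "step_kernel p r t x =
     distr (PiM (cells t) (\<lambda>i. measure_pmf (cell_update p r (x i, x (i + 1)))))
       line_space (glue_cells t)"

text \<open>
  The kernels of the Markov chain of lines in the form required by the Ionescu-Tulcea theorem:
  the law of line \<open>n\<close> given the lines \<open>\<omega> 0, \<dots>, \<omega> (n - 1)\<close>.
\<close>

fun line_kernel ::
  "(int \<Rightarrow> bool) measure \<Rightarrow> real \<Rightarrow> real \<Rightarrow> nat \<Rightarrow> (nat \<Rightarrow> int \<Rightarrow> bool) \<Rightarrow> (int \<Rightarrow> bool) measure" where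
  "line_kernel \<mu> p r 0 \<omega> = \<mu>"
| "line_kernel \<mu> p r (Suc t) \<omega> = step_kernel p r t (\<omega> t)"

definition chain_law ::
  "(int \<Rightarrow> bool) measure \<Rightarrow> real \<Rightarrow> real \<Rightarrow> (nat \<Rightarrow> int \<Rightarrow> bool) measure" where
  "chain_law \<mu> p r =
     projective_family.lim UNIV
       (Ionescu_Tulcea.CI (line_kernel \<mu> p r) (\<lambda>_. line_space)) (\<lambda>_. line_space)"

definition field_law ::
  "(int \<Rightarrow> bool) measure \<Rightarrow> real \<Rightarrow> real \<Rightarrow> (int \<times> nat \<Rightarrow> bool) measure" where
  "field_law \<mu> p r = distr (chain_law \<mu> p r) field_space (\<lambda>\<omega> (i, t). \<omega> t i)"

text \<open>
  Weak convergence of measures on a topological space. The library's \<open>weak_conv_m\<close> is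
  restricted to the real line. On \<^typ>\<open>int \<Rightarrow> bool\<close> the topology of the type class is the
  product of the discrete topologies.
\<close>

definition weakly_converges ::
  "(nat \<Rightarrow> 'a::topological_space measure) \<Rightarrow> 'a measure \<Rightarrow> bool" where
  "weakly_converges \<nu> \<nu>' \<longleftrightarrow>
     (\<forall>f::'a \<Rightarrow> real. continuous_on UNIV f \<and> bounded (range f) \<longrightarrow>
        (\<lambda>n. integral\<^sup>L (\<nu> n) f) \<longlonglongrightarrow> integral\<^sup>L \<nu>' f)"

text \<open>The definitions above are meaningful: sigma-algebras agree and the kernels are Markov.\<close>

instance bool :: second_countable_topology
proof
  have "open = generate_topology (UNIV :: bool set set)"
    by (auto simp: fun_eq_iff intro: Topological_Spaces.open_discrete generate_topology.Basis)
  then show "\<exists>B :: bool set set. countable B \<and> open = generate_topology B"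
    by (intro exI[of _ UNIV]) auto
qed

lemma sets_line_space: "sets line_space = sets borel"
proof -
  have "sets line_space = sets (PiM UNIV (\<lambda>_::int. borel :: bool measure))"
    by (rule sets_PiM_cong) (auto simp: sets_borel_eq_count_space)
  also have "\<dots> = sets borel"
    by (rule sets_PiM_equal_borel)
  finally show ?thesis .
qed

lemma sets_PM_half: "sets PM_half = sets line_space"
  unfolding PM_half_def by (rule sets_PiM_cong) auto

lemma prob_space_PM_half: "prob_space PM_half"
  unfolding PM_half_def by (rule prob_space_PiM) (rule prob_space_measure_pmf)

lemma measurable_PiM_kernel:
  assumes K: "\<And>i. i \<in> I \<Longrightarrow> K i \<in> N \<rightarrow>\<^sub>M prob_algebra (M i)"
  shows "(\<lambda>x. PiM I (\<lambda>i. K i x)) \<in> N \<rightarrow>\<^sub>M prob_algebra (PiM I M)"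
proof (rule measurable_prob_algebra_generated[OF sets_PiM Int_stable_prod_algebra])
  show "prod_algebra I M \<subseteq> Pow (\<Pi>\<^sub>E i\<in>I. space (M i))"
    by (rule prod_algebra_sets_into_space)
  have K_prob: "prob_space (K i x)" and K_sets: "sets (K i x) = sets (M i)"
    if "i \<in> I" "x \<in> space N" for i x
    using measurable_space[OF K[OF that(1)] that(2)] by (auto simp: space_prob_algebra)
  show "prob_space (PiM I (\<lambda>i. K i x))" if "x \<in> space N" for x
    using that by (intro prob_space_PiM K_prob)
  show sets: "sets (PiM I (\<lambda>i. K i x)) = sets (PiM I M)" if "x \<in> space N" for x
    using that by (intro sets_PiM_cong K_sets refl)
  fix A assume "A \<in> prod_algebra I M"
  then obtain J E where A: "A = prod_emb I M J (\<Pi>\<^sub>E j\<in>J. E j)" and J: "finite J" "J \<subseteq> I"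
    and E: "\<And>j. j \<in> J \<Longrightarrow> E j \<in> sets (M j)"
    by (elim prod_algebraE) auto
  have "emeasure (PiM I (\<lambda>i. K i x)) A = (\<Prod>j\<in>J. emeasure (K j x) (E j))"
    if x: "x \<in> space N" for x
  proof -
    have "A = prod_emb I (\<lambda>i. K i x) J (\<Pi>\<^sub>E j\<in>J. E j)"
      unfolding A prod_emb_def
      using K_sets[OF _ x, THEN sets_eq_imp_space_eq] by (simp cong: PiE_cong)
    then show ?thesis
      using J E K_sets[OF _ x] K_prob[OF _ x]
      by (auto intro!: emeasure_PiM_emb)
  qed
  moreover have "(\<lambda>x. \<Prod>j\<in>J. emeasure (K j x) (E j)) \<in> borel_measurable N"
  proof (rule borel_measurable_prod_ennreal)
    fix j assume j: "j \<in> J"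
    have "K j \<in> N \<rightarrow>\<^sub>M subprob_algebra (M j)"
      using j J by (intro measurable_prob_algebraD K) auto
    then show "(\<lambda>x. emeasure (K j x) (E j)) \<in> borel_measurable N"
      by (rule measurable_emeasure_kernel) (rule E[OF j])
  qed
  ultimately show "(\<lambda>x. emeasure (PiM I (\<lambda>i. K i x)) A) \<in> borel_measurable N"
    by (simp cong: measurable_cong)
qed

lemma measurable_glue_cells:
  "glue_cells t \<in> PiM (cells t) (\<lambda>_. count_space UNIV) \<rightarrow>\<^sub>M line_space"
proof (rule measurable_PiM_single')
  fix i :: int
  let ?N = "PiM (cells t) (\<lambda>_. count_space UNIV) :: (int \<Rightarrow> bool \<times> bool) measure"
  have comp: "(\<lambda>c. h (c j)) \<in> ?N \<rightarrow>\<^sub>M count_space UNIV"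
    if "j \<in> cells t" for j and h :: "bool \<times> bool \<Rightarrow> bool"
    by (rule measurable_compose[OF measurable_component_singleton[OF that]]) simp
  show "(\<lambda>c. glue_cells t c i) \<in> ?N \<rightarrow>\<^sub>M count_space UNIV"
  proof (cases "i \<in> cells t")
    case True
    then show ?thesis using comp[OF True, of fst] by (simp add: glue_cells_def)
  next
    case False
    then have "i - 1 \<in> cells t" by (auto simp: cells_def)
    then show ?thesis using comp[of "i - 1" snd] False by (simp add: glue_cells_def)
  qed
qed (simp add: space_PiM)

lemma measurable_step_kernel: "step_kernel p r t \<in> line_space \<rightarrow>\<^sub>M prob_algebra line_space"
proof -
  have "(\<lambda>x. measure_pmf (cell_update p r (x i, x (i + 1))))
      \<in> line_space \<rightarrow>\<^sub>M prob_algebra (count_space UNIV)" for i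
  proof -
    have "(\<lambda>x. (x i, x (i + 1))) \<in> line_space \<rightarrow>\<^sub>M count_space UNIV \<Otimes>\<^sub>M count_space UNIV"
      by (intro measurable_Pair measurable_component_singleton) auto
    then have "(\<lambda>x. (x i, x (i + 1))) \<in> line_space \<rightarrow>\<^sub>M (count_space UNIV :: (bool \<times> bool) measure)"
      by (simp add: pair_measure_countable)
    then show ?thesis
      by (rule measurable_compose)
         (auto simp: space_prob_algebra prob_space_measure_pmf)
  qed
  then have "(\<lambda>x. PiM (cells t) (\<lambda>i. measure_pmf (cell_update p r (x i, x (i + 1)))))
      \<in> line_space \<rightarrow>\<^sub>M prob_algebra (PiM (cells t) (\<lambda>_. count_space UNIV))"
    by (intro measurable_PiM_kernel)
  from measurable_compose[OF this measurable_distr_prob_space[OF measurable_glue_cells]]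
  show ?thesis
    by (simp add: step_kernel_def[abs_def])
qed

lemma Ionescu_Tulcea_line_kernel:
  assumes "prob_space \<mu>" "sets \<mu> = sets line_space"
  shows "Ionescu_Tulcea (line_kernel \<mu> p r) (\<lambda>_. line_space)"
proof -
  have \<mu>: "\<mu> \<in> space (prob_algebra line_space)"
    using assms by (simp add: space_prob_algebra)
  have *: "line_kernel \<mu> p r n \<in> PiM {0..<n} (\<lambda>_. line_space) \<rightarrow>\<^sub>M prob_algebra line_space" for n
  proof (cases n)
    case 0
    moreover have "line_kernel \<mu> p r 0 = (\<lambda>_. \<mu>)" by (simp add: fun_eq_iff)
    ultimately show ?thesis using \<mu> by simp
  next
    case (Suc t)
    have "(\<lambda>\<omega>. \<omega> t) \<in> PiM {0..<n} (\<lambda>_. line_space) \<rightarrow>\<^sub>M line_space"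
      using Suc by (intro measurable_component_singleton) simp
    from measurable_compose[OF this measurable_step_kernel[of p r t]]
    have "(\<lambda>\<omega>. step_kernel p r t (\<omega> t)) \<in> PiM {0..<n} (\<lambda>_. line_space) \<rightarrow>\<^sub>M prob_algebra line_space" .
    moreover have "line_kernel \<mu> p r n = (\<lambda>\<omega>. step_kernel p r t (\<omega> t))"
      using Suc by (simp add: fun_eq_iff)
    ultimately show ?thesis by simp
  qed
  show ?thesis
  proof (rule Ionescu_Tulcea.intro)
    show "line_kernel \<mu> p r n \<in> PiM {0..<n} (\<lambda>_. line_space) \<rightarrow>\<^sub>M subprob_algebra line_space" for n
      by (rule measurable_prob_algebraD[OF *])
    fix n :: nat and \<omega>
    assume "\<omega> \<in> space (PiM {0..<n} (\<lambda>_. line_space :: (int \<Rightarrow> bool) measure))"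
    from measurable_space[OF * this] show "prob_space (line_kernel \<mu> p r n \<omega>)"
      by (simp add: space_prob_algebra)
  qed
qed

end

theory Submission
  imports Defs
begin

text \<open>
  Write a line as spins $\pm 1$ and test it against the characters
  $\chi_A(x) = \prod_{i \in A} x_i$. A cell update preserves the product of the two spins of the
  cell, and replaces the expectation of a single spin $s$, with neighbour $s'$, by
  $(r - p) s + (r + p - 1) s'$. So $\chi_A$ at time $t + 1$ has as conditional expectation a signed
  combination of characters $\chi_B$, $|B| = |A|$, of total mass at most $\rho^k$, where
  $\rho = |r - p| + |r + p - 1| < 1$ and $k$ is the number of cells that meet $A$ in exactly one
  site. A nonempty finite $A$ cannot be a union of cells at two consecutive times, because its
  maximum would have to be the right end of a cell both times; hence
  $|E \chi_A| \le \rho^{\lfloor t/2 \rfloor}$ at time $t$, whatever the initial law. Characters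
  determine weak convergence by Stone-Weierstrass.
\<close>

section \<open>Independent coordinates, spins and characters\<close>

lemma (in product_prob_space) integral_prod_coordinates:
  fixes f :: "'i \<Rightarrow> 'a \<Rightarrow> real"
  assumes J: "finite J" "J \<subseteq> I" and f: "\<And>j. j \<in> J \<Longrightarrow> integrable (M j) (f j)"
  shows "(\<integral>x. (\<Prod>j\<in>J. f j (x j)) \<partial>PiM I M) = (\<Prod>j\<in>J. \<integral>y. f j y \<partial>M j)"
proof -
  have [measurable]: "f j \<in> borel_measurable (M j)" if "j \<in> J" for j
    using f[OF that] by simp
  have "(\<Prod>j\<in>J. \<integral>y. f j y \<partial>M j) = (\<integral>x. (\<Prod>j\<in>J. f j (x j)) \<partial>PiM J M)"
    by (rule product_integral_prod[symmetric]) (use J f in auto)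
  \<comment> \<open>Only coordinates in \<open>J\<close> enter the integrand, so the finite product
    measure can be replaced by the marginal of the full one.\<close>
  also have "\<dots> = (\<integral>x. (\<Prod>j\<in>J. f j (x j)) \<partial>distr (PiM I M) (PiM J M) (\<lambda>x. restrict x J))"
    using J by (simp add: distr_PiM_restrict_finite)
  also have "\<dots> = (\<integral>x. (\<Prod>j\<in>J. f j (restrict x J j)) \<partial>PiM I M)"
    using J by (intro integral_distr measurable_restrict_subset borel_measurable_prod) auto
  finally show ?thesis
    by simp
qed

definition spin :: "bool \<Rightarrow> real" where
  "spin b = (if b then 1 else -1)"

definition character :: "int set \<Rightarrow> (int \<Rightarrow> bool) \<Rightarrow> real" where
  "character A x = (\<Prod>i\<in>A. spin (x i))"

lemma abs_spin [simp]: "\<bar>spin b\<bar> = 1"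
  by (simp add: spin_def)

lemma spin_mult_self [simp]: "spin b * spin b = 1"
  by (simp add: spin_def)

lemma abs_character [simp]: "\<bar>character A x\<bar> = 1"
  by (simp add: character_def abs_prod)

lemma character_empty [simp]: "character {} = (\<lambda>_. 1)"
  by (simp add: character_def fun_eq_iff)

text \<open>Spins square to 1, so the sites common to \<open>A\<close> and \<open>B\<close>
  cancel.\<close>

lemma character_mult:
  assumes "finite A" "finite B"
  shows "character A x * character B x = character (sym_diff A B) x"
proof -
  have "character A x = character (A - B) x * character (A \<inter> B) x"
    "character B x = character (B - A) x * character (A \<inter> B) x"
    using assms unfolding character_def
    by (subst prod.union_disjoint[symmetric]; auto intro!: prod.cong)+
  moreover have "character (A \<inter> B) x * character (A \<inter> B) x = 1"
    by (simp add: character_def prod.distrib[symmetric])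
  moreover have "character (sym_diff A B) x = character (A - B) x * character (B - A) x"
    using assms unfolding character_def by (intro prod.union_disjoint) auto
  ultimately show ?thesis
    by (simp add: algebra_simps)
qed

lemma measurable_character [measurable]: "character A \<in> borel_measurable line_space"
proof -
  have "(\<lambda>x. spin (x i)) \<in> borel_measurable line_space" for i :: int
    by (rule measurable_compose[OF measurable_component_singleton]) auto
  then show ?thesis
    unfolding character_def[abs_def] by measurable
qed

lemma continuous_character: "continuous_on UNIV (character A)"
proof -
  have "continuous_on UNIV (\<lambda>x :: int \<Rightarrow> bool. spin (x i))" for i
  proof -
    have "continuous_on UNIV (\<lambda>x :: int \<Rightarrow> bool. x i)"
      by (rule continuous_on_product_coordinates)
    with Topological_Spaces.continuous_on_discrete[of UNIV spin] show ?thesis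
      by (rule continuous_on_compose2) simp
  qed
  then show ?thesis
    unfolding character_def[abs_def] by (intro continuous_on_prod)
qed

section \<open>Characters determine weak convergence\<close>

inductive_set character_span :: "((int \<Rightarrow> bool) \<Rightarrow> real) set" where
  character: "finite A \<Longrightarrow> (\<lambda>x. c * character A x) \<in> character_span"
| add: "f \<in> character_span \<Longrightarrow> g \<in> character_span \<Longrightarrow> (\<lambda>x. f x + g x) \<in> character_span"

text \<open>By bilinearity, a nested induction reduces the product to that of two characters, which
  is again a character. This makes the span an algebra, as Stone-Weierstrass requires.\<close>

lemma character_span_mult:
  assumes "f \<in> character_span" "g \<in> character_span"
  shows "(\<lambda>x. f x * g x) \<in> character_span"
  using assms
proof (induction rule: character_span.induct)
  case (character A c)
  from character(2) show ?case
  proof (induction rule: character_span.induct)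
    case (character B d)
    have "(\<lambda>x. c * character A x * (d * character B x)) = (\<lambda>x. c * d * character (sym_diff A B) x)"
      using character_mult[OF \<open>finite A\<close> \<open>finite B\<close>] by (simp add: fun_eq_iff mult_ac)
    then show ?case
      using \<open>finite A\<close> \<open>finite B\<close> by (auto intro!: character_span.character)
  next
    case (add g h)
    then show ?case
      by (simp add: distrib_left character_span.add)
  qed
next
  case (add f h)
  then show ?case
    by (simp add: distrib_right character_span.add)
qed

text \<open>Tychonoff's theorem: every factor is finite, hence compact.\<close>

lemma compact_UNIV_lines: "compact (UNIV :: (int \<Rightarrow> bool) set)"
proof -
  have "compact_space (product_topology (\<lambda>_ :: int. euclidean :: bool topology) UNIV)"
    by (subst compact_space_product_topology)
       (auto simp: compact_space_def intro: finite_imp_compact)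
  then show ?thesis
    by (simp add: euclidean_product_topology compact_space_def compactin_euclidean_iff)
qed

lemma open_coordinate_vimage:
  "open W \<Longrightarrow> open {z :: 'a \<Rightarrow> 'b::topological_space. z i \<in> W}"
  using open_vimage[of W "\<lambda>z :: 'a \<Rightarrow> 'b. z i"] by (simp add: vimage_def)

text \<open>
  The library makes \<^typ>\<open>'a \<Rightarrow> 'b\<close> a Hausdorff space only for countable \<^typ>\<open>'a\<close> and
  metric \<^typ>\<open>'b\<close>, and \<^typ>\<open>bool\<close> is not an instance of \<^class>\<open>metric_space\<close>.
\<close>

instance "fun" :: (type, t0_space) t0_space
proof
  fix x y :: "'a \<Rightarrow> 'b" assume "x \<noteq> y"
  then obtain i where "x i \<noteq> y i" by auto
  then obtain U where U: "open U" "\<not> (x i \<in> U \<longleftrightarrow> y i \<in> U)"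
    using separation_t0[of "x i" "y i"] by auto
  show "\<exists>U. open U \<and> \<not> (x \<in> U \<longleftrightarrow> y \<in> U)"
    using U by (intro exI[of _ "{z. z i \<in> U}"]) (auto intro: open_coordinate_vimage)
qed

instance "fun" :: (type, t1_space) t1_space
proof
  fix x y :: "'a \<Rightarrow> 'b" assume "x \<noteq> y"
  then obtain i where "x i \<noteq> y i" by auto
  then obtain U where U: "open U" "x i \<in> U" "y i \<notin> U"
    using separation_t1[of "x i" "y i"] by auto
  show "\<exists>U. open U \<and> x \<in> U \<and> y \<notin> U"
    using U by (intro exI[of _ "{z. z i \<in> U}"]) (auto intro: open_coordinate_vimage)
qed

instance "fun" :: (type, t2_space) t2_space
proof
  fix x y :: "'a \<Rightarrow> 'b" assume "x \<noteq> y"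
  then obtain i where "x i \<noteq> y i" by auto
  then obtain U V where UV: "open U" "open V" "x i \<in> U" "y i \<in> V" "U \<inter> V = {}"
    by (meson hausdorff)
  then show "\<exists>U V. open U \<and> open V \<and> x \<in> U \<and> y \<in> V \<and> U \<inter> V = {}"
    by (intro exI[of _ "{z. z i \<in> U}"] exI[of _ "{z. z i \<in> V}"])
       (auto intro: open_coordinate_vimage)
qed

text \<open>Constants are multiples of the empty character, and two distinct lines are separated by
  the character of a single site where they differ.\<close>

lemma function_ring_character_span: "function_ring_on character_span UNIV"
proof
  show "compact (UNIV :: (int \<Rightarrow> bool) set)"
    by (rule compact_UNIV_lines)
  show "continuous_on UNIV f" if "f \<in> character_span" for f
    using that
    by induction (auto intro!: continuous_intros continuous_character)
  show "(\<lambda>_. c) \<in> character_span" for c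
    using character_span.character[of "{}" c] by simp
  fix x y :: "int \<Rightarrow> bool" assume "x \<noteq> y"
  then obtain i where "x i \<noteq> y i" by auto
  then have "1 * character {i} x \<noteq> 1 * character {i} y"
    by (auto simp: character_def spin_def split: if_splits)
  then show "\<exists>f\<in>character_span. f x \<noteq> f y"
    by (intro bexI[OF _ character_span.character[of "{i}" 1]]) auto
qed (auto intro: character_span.add character_span_mult)

text \<open>Integrals against probability measures move by at most the uniform distance of the
  integrands. A uniform approximation from the span therefore costs the same error for all
  \<open>t\<close> and for the limit, and an argument with three errors of size
  \<open>\<epsilon> / 3\<close> concludes.\<close>

lemma weakly_converges_characters:
  assumes prob: "\<And>t. prob_space (\<nu> t)" "prob_space \<nu>'"
    and sets: "\<And>t. sets (\<nu> t) = sets line_space" "sets \<nu>' = sets line_space"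
    and lim: "\<And>A. finite A \<Longrightarrow>
      (\<lambda>t. integral\<^sup>L (\<nu> t) (character A)) \<longlonglongrightarrow> integral\<^sup>L \<nu>' (character A)"
  shows "weakly_converges \<nu> \<nu>'"
  unfolding weakly_converges_def
proof (intro allI impI)
  interpret function_ring_on character_span UNIV
    by (rule function_ring_character_span)
  \<comment> \<open>Continuity gives measurability because the product and Borel sigma-algebras
    agree; compactness gives a bound.\<close>
  have integrable: "integrable N f"
    if N: "prob_space N" "sets N = sets line_space" and f: "continuous_on UNIV f"
    for N and f :: "(int \<Rightarrow> bool) \<Rightarrow> real"
  proof -
    interpret prob_space N by fact
    have "f \<in> borel_measurable N"
      using borel_measurable_continuous_onI[OF f] N(2) sets_line_space
      by (simp cong: measurable_cong_sets)
    moreover have "bounded (range f)"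
      by (intro compact_imp_bounded compact_continuous_image f compact_UNIV_lines)
    then obtain B where "\<And>x. norm (f x) \<le> B"
      by (auto simp: bounded_iff)
    ultimately show ?thesis
      by (intro integrable_const_bound[of _ B]) auto
  qed
  have span: "(\<lambda>t. integral\<^sup>L (\<nu> t) g) \<longlonglongrightarrow> integral\<^sup>L \<nu>' g" if "g \<in> character_span" for g
    using that
  proof induction
    case (character A c)
    then show ?case by (simp add: lim tendsto_mult_left)
  next
    case (add g h)
    then show ?case
      using integrable[OF prob(1) sets(1) continuous] integrable[OF prob(2) sets(2) continuous]
      by (simp add: tendsto_add)
  qed
  fix f :: "(int \<Rightarrow> bool) \<Rightarrow> real"
  assume "continuous_on UNIV f \<and> bounded (range f)"
  then have f: "continuous_on UNIV f" ..
  show "(\<lambda>t. integral\<^sup>L (\<nu> t) f) \<longlonglongrightarrow> integral\<^sup>L \<nu>' f"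
  proof (rule LIMSEQ_I)
    fix \<epsilon> :: real assume \<epsilon>: "0 < \<epsilon>"
    then obtain g where g: "g \<in> character_span" and fg: "\<And>x. \<bar>f x - g x\<bar> < \<epsilon> / 3"
      using Stone_Weierstrass_basic[OF f, of "\<epsilon> / 3"] by auto
    have close: "\<bar>integral\<^sup>L N f - integral\<^sup>L N g\<bar> \<le> \<epsilon> / 3"
      if N: "prob_space N" "sets N = sets line_space" for N
    proof -
      interpret prob_space N by fact
      note int = integrable[OF N f] integrable[OF N continuous[OF g]]
      have "\<bar>integral\<^sup>L N f - integral\<^sup>L N g\<bar> = \<bar>\<integral>x. f x - g x \<partial>N\<bar>"
        using int by simp
      also have "\<dots> \<le> (\<integral>x. \<bar>f x - g x\<bar> \<partial>N)"
        by (rule integral_abs_bound)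
      also have "\<dots> \<le> (\<integral>x. \<epsilon> / 3 \<partial>N)"
        using int fg by (intro integral_mono) (auto intro: less_imp_le)
      finally show ?thesis
        by (simp add: prob_space)
    qed
    from LIMSEQ_D[OF span[OF g], of "\<epsilon> / 3"] \<epsilon> obtain n where
      n: "\<And>t. t \<ge> n \<Longrightarrow> \<bar>integral\<^sup>L (\<nu> t) g - integral\<^sup>L \<nu>' g\<bar> < \<epsilon> / 3"
      by auto
    have "norm (integral\<^sup>L (\<nu> t) f - integral\<^sup>L \<nu>' f) < \<epsilon>" if "t \<ge> n" for t
      using n[OF that] close[OF prob(1) sets(1), of t] close[OF prob(2) sets(2)]
      unfolding real_norm_def by linarith
    then show "\<exists>n. \<forall>t\<ge>n. norm (integral\<^sup>L (\<nu> t) f - integral\<^sup>L \<nu>' f) < \<epsilon>"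
      by blast
  qed
qed

text \<open>The mean factors over the sites by independence, and a fair spin has mean 0.\<close>

lemma integral_character_PM_half:
  assumes "finite A" "A \<noteq> {}"
  shows "integral\<^sup>L PM_half (character A) = 0"
proof -
  interpret product_prob_space "\<lambda>_ :: int. measure_pmf (bernoulli_pmf (1 / 2))" UNIV
    by standard
  have "integral\<^sup>L PM_half (character A)
      = (\<Prod>i\<in>A. measure_pmf.expectation (bernoulli_pmf (1 / 2)) spin)"
    unfolding PM_half_def character_def
    using assms by (intro integral_prod_coordinates) (auto intro: integrable_measure_pmf_finite)
  also have "measure_pmf.expectation (bernoulli_pmf (1 / 2)) spin = 0"
    by (simp add: spin_def)
  finally show ?thesis
    using assms by (simp add: power_0_left)
qed

section \<open>Cells and the effect of one step on characters\<close>

definition cell_of :: "nat \<Rightarrow> int \<Rightarrow> int" where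
  "cell_of t i = (if i \<in> cells t then i else i - 1)"

definition partner :: "nat \<Rightarrow> int \<Rightarrow> int" where
  "partner t i = (if i \<in> cells t then i + 1 else i - 1)"

lemma cells_add_1 [simp]: "i + 1 \<in> cells t \<longleftrightarrow> i \<notin> cells t"
  and cells_diff_1 [simp]: "i - 1 \<in> cells t \<longleftrightarrow> i \<notin> cells t"
  and cells_Suc [simp]: "i \<in> cells (Suc t) \<longleftrightarrow> i \<notin> cells t"
  by (auto simp: cells_def)

lemma cell_of_in_cells [simp]: "cell_of t i \<in> cells t"
  by (simp add: cell_of_def)

lemma inj_partner: "inj (partner t)"
proof (rule injI)
  have "partner t (partner t i) = i" for i
    by (simp add: partner_def)
  then show "partner t i = partner t j \<Longrightarrow> i = j" for i j
    by metis
qed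

text \<open>Under \<open>step_kernel\<close> the cells are independent but the two sites of a cell
  are not. Products over sites are therefore regrouped by cells, a site outside \<open>A\<close>
  contributing 1.\<close>

lemma prod_over_cells:
  fixes F :: "int \<Rightarrow> real"
  assumes "finite A"
  shows "(\<Prod>i\<in>A. F i) =
    (\<Prod>j\<in>cell_of t ` A. (if j \<in> A then F j else 1) * (if j + 1 \<in> A then F (j + 1) else 1))"
proof -
  have "(\<Prod>i\<in>A. F i) = (\<Prod>j\<in>cell_of t ` A. \<Prod>i\<in>{i \<in> A. cell_of t i = j}. F i)"
    by (rule prod.group[symmetric]) (use assms in auto)
  also have "\<dots> = (\<Prod>j\<in>cell_of t ` A. (if j \<in> A then F j else 1) * (if j + 1 \<in> A then F (j + 1) else 1))"
  proof (rule prod.cong[OF refl])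
    fix j assume "j \<in> cell_of t ` A"
    then have "j \<in> cells t" by auto
    then have "{i \<in> A. cell_of t i = j} = A \<inter> {j, j + 1}"
      by (auto simp: cell_of_def split: if_splits)
    then show "(\<Prod>i\<in>{i \<in> A. cell_of t i = j}. F i)
        = (if j \<in> A then F j else 1) * (if j + 1 \<in> A then F (j + 1) else 1)"
      by (simp add: Int_insert_right)
  qed
  finally show ?thesis .
qed

text \<open>Swapping two opposite spins flips both, so every update either keeps both spins or flips
  both; hence the product is preserved. The mean of a single new spin is its old value times
  \<open>2 * r - 1\<close> if the pair was equal and \<open>1 - 2 * p\<close> if not, and the linear
  forms in both spins combine these two cases.\<close>

lemma expectation_cell_update:
  assumes "0 \<le> p" "p \<le> 1" "0 \<le> r" "r \<le> 1"
  shows "measure_pmf.expectation (cell_update p r (a, b)) (\<lambda>y. spin (fst y))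
      = (r - p) * spin a + (r + p - 1) * spin b"
    and "measure_pmf.expectation (cell_update p r (a, b)) (\<lambda>y. spin (snd y))
      = (r - p) * spin b + (r + p - 1) * spin a"
    and "measure_pmf.expectation (cell_update p r (a, b)) (\<lambda>y. spin (fst y) * spin (snd y))
      = spin a * spin b"
  using assms by (cases a; cases b; simp add: spin_def algebra_simps)+

text \<open>The conditional mean of a character factors over cells; this distributes the factor of
  each cell over its sites. If both sites of a cell lie in \<open>A\<close>, the preserved product
  of spins is shared out as one old spin per site.\<close>

definition site_factor ::
  "real \<Rightarrow> real \<Rightarrow> nat \<Rightarrow> int set \<Rightarrow> (int \<Rightarrow> bool) \<Rightarrow> int \<Rightarrow> real" where
  "site_factor p r t A x i =
     (if partner t i \<in> A then spin (x i)
      else (r - p) * spin (x i) + (r + p - 1) * spin (x (partner t i)))"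

lemma integral_character_step_kernel:
  assumes "0 \<le> p" "p \<le> 1" "0 \<le> r" "r \<le> 1" and A: "finite A"
  shows "integral\<^sup>L (step_kernel p r t x) (character A) = (\<Prod>i\<in>A. site_factor p r t A x i)"
proof -
  let ?q = "\<lambda>i. cell_update p r (x i, x (i + 1))"
  let ?h = "\<lambda>j (y :: bool \<times> bool). (if j \<in> A then spin (fst y) else 1) * (if j + 1 \<in> A then spin (snd y) else 1)"
  interpret product_prob_space "\<lambda>i. measure_pmf (?q i)" "cells t"
    by standard
  have glue: "glue_cells t \<in> PiM (cells t) (\<lambda>i. measure_pmf (?q i)) \<rightarrow>\<^sub>M line_space"
    using measurable_glue_cells[of t]
    by (subst measurable_cong_sets[OF sets_PiM_cong refl]) auto
  have "integral\<^sup>L (step_kernel p r t x) (character A)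
      = (\<integral>c. character A (glue_cells t c) \<partial>PiM (cells t) (\<lambda>i. measure_pmf (?q i)))"
    unfolding step_kernel_def by (rule integral_distr[OF glue measurable_character])
  also have "\<dots> = (\<integral>c. (\<Prod>j\<in>cell_of t ` A. ?h j (c j)) \<partial>PiM (cells t) (\<lambda>i. measure_pmf (?q i)))"
  proof (intro Bochner_Integration.integral_cong refl)
    fix c :: "int \<Rightarrow> bool \<times> bool"
    show "character A (glue_cells t c) = (\<Prod>j\<in>cell_of t ` A. ?h j (c j))"
      unfolding character_def prod_over_cells[OF A, of _ t]
      by (intro prod.cong refl) (auto simp: glue_cells_def)
  qed
  also have "\<dots> = (\<Prod>j\<in>cell_of t ` A. measure_pmf.expectation (?q j) (?h j))"
    using A by (intro integral_prod_coordinates) (auto intro: integrable_measure_pmf_finite)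
  also have "\<dots> = (\<Prod>i\<in>A. site_factor p r t A x i)"
    unfolding prod_over_cells[OF A, of "site_factor p r t A x" t]
  proof (intro prod.cong refl)
    fix j assume "j \<in> cell_of t ` A"
    then have j: "j \<in> cells t" by auto
    show "measure_pmf.expectation (?q j) (?h j)
        = (if j \<in> A then site_factor p r t A x j else 1) *
          (if j + 1 \<in> A then site_factor p r t A x (j + 1) else 1)"
      \<comment> \<open>The first two identities serve the cells with one site in \<open>A\<close>,
        the third those with both.\<close>
      using j expectation_cell_update[OF assms(1-4), of "x j" "x (j + 1)"]
      by (simp add: site_factor_def partner_def del: cell_update.simps)
  qed
  finally show ?thesis .
qed

text \<open>Each of these sites is alone in its cell, so the cardinality is the exponent
  \<open>k\<close> of the introductory comment.\<close>

definition lonely :: "nat \<Rightarrow> int set \<Rightarrow> int set" where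
  "lonely t A = {i \<in> A. partner t i \<notin> A}"

text \<open>Expand the product of the two-term factors at the lonely sites: \<open>X\<close>
  collects the sites where the old spin of the site itself is chosen, and the others move to their
  partners.\<close>

lemma prod_site_factor:
  assumes A: "finite A"
  shows "(\<Prod>i\<in>A. site_factor p r t A x i) =
    (\<Sum>X\<in>Pow (lonely t A). (r - p) ^ card X * (r + p - 1) ^ card (lonely t A - X) *
       character (A - lonely t A \<union> X \<union> partner t ` (lonely t A - X)) x)"
proof -
  let ?S = "lonely t A"
  have S: "finite ?S" "?S \<subseteq> A"
    using A by (auto simp: lonely_def)
  have "(\<Prod>i\<in>A. site_factor p r t A x i)
      = (\<Prod>i\<in>A - ?S. site_factor p r t A x i) * (\<Prod>i\<in>?S. site_factor p r t A x i)"
    by (rule prod.subset_diff[OF S(2) A])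
  also have "(\<Prod>i\<in>A - ?S. site_factor p r t A x i) = character (A - ?S) x"
    unfolding character_def by (intro prod.cong) (auto simp: site_factor_def lonely_def)
  also have "(\<Prod>i\<in>?S. site_factor p r t A x i)
      = (\<Prod>i\<in>?S. (r - p) * spin (x i) + (r + p - 1) * spin (x (partner t i)))"
    by (intro prod.cong) (auto simp: site_factor_def lonely_def)
  also have "\<dots> = (\<Sum>X\<in>Pow ?S. (\<Prod>i\<in>X. (r - p) * spin (x i)) *
      (\<Prod>i\<in>?S - X. (r + p - 1) * spin (x (partner t i))))"
    by (rule prod_add[OF S(1)])
  also have "\<dots> = (\<Sum>X\<in>Pow ?S. (r - p) ^ card X * (r + p - 1) ^ card (?S - X) *
      (character X x * character (partner t ` (?S - X)) x))"
    by (simp add: character_def prod.distrib prod.reindex inj_on_subset[OF inj_partner] mult_ac)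
  also have "character (A - ?S) x * \<dots> = (\<Sum>X\<in>Pow ?S. (r - p) ^ card X * (r + p - 1) ^ card (?S - X) *
       (character (A - ?S) x * character X x * character (partner t ` (?S - X)) x))"
    by (simp add: sum_distrib_left mult_ac)
  also have "\<dots> = (\<Sum>X\<in>Pow ?S. (r - p) ^ card X * (r + p - 1) ^ card (?S - X) *
       character (A - ?S \<union> X \<union> partner t ` (?S - X)) x)"
  proof (intro sum.cong refl arg_cong2[where f = times])
    fix X assume "X \<in> Pow ?S"
    then have X: "X \<subseteq> ?S" "finite X"
      using S by (auto intro: finite_subset)
    have "character (A - ?S \<union> X) x = character (A - ?S) x * character X x"
      unfolding character_def using A X by (intro prod.union_disjoint) auto
    \<comment> \<open>Partners of lonely sites lie outside \<open>A\<close>, so moved sites never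
      collide with those that stay.\<close>
    moreover have "character (A - ?S \<union> X \<union> partner t ` (?S - X)) x
        = character (A - ?S \<union> X) x * character (partner t ` (?S - X)) x"
      unfolding character_def using A X S
      by (intro prod.union_disjoint) (auto simp: lonely_def)
    ultimately show "character (A - ?S) x * character X x * character (partner t ` (?S - X)) x
        = character (A - ?S \<union> X \<union> partner t ` (?S - X)) x"
      by simp
  qed
  finally show ?thesis .
qed

text \<open>The absolute values of the coefficients in \<open>prod_site_factor\<close> sum to the
  stated power, by the same expansion read backwards.\<close>

lemma abs_integral_prod_site_factor_le:
  assumes N: "prob_space N" "sets N = sets line_space"
    and A: "finite A" "A \<noteq> {}"
    and K: "\<And>B. finite B \<Longrightarrow> B \<noteq> {} \<Longrightarrow> \<bar>integral\<^sup>L N (character B)\<bar> \<le> K"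
  shows "\<bar>\<integral>x. (\<Prod>i\<in>A. site_factor p r t A x i) \<partial>N\<bar>
    \<le> (\<bar>r - p\<bar> + \<bar>r + p - 1\<bar>) ^ card (lonely t A) * K"
proof -
  interpret prob_space N by fact
  let ?S = "lonely t A"
  let ?B = "\<lambda>X. A - ?S \<union> X \<union> partner t ` (?S - X)"
  let ?c = "\<lambda>X. (r - p) ^ card X * (r + p - 1) ^ card (?S - X)"
  have S: "finite ?S" "?S \<subseteq> A"
    using A by (auto simp: lonely_def)
  have int: "integrable N (character B)" for B
    by (rule integrable_const_bound[of _ 1])
       (simp_all add: measurable_cong_sets[OF N(2) refl])
  have "\<bar>\<integral>x. (\<Prod>i\<in>A. site_factor p r t A x i) \<partial>N\<bar>
      = \<bar>\<Sum>X\<in>Pow ?S. ?c X * integral\<^sup>L N (character (?B X))\<bar>"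
    using int by (simp add: prod_site_factor[OF A(1)])
  also have "\<dots> \<le> (\<Sum>X\<in>Pow ?S. \<bar>?c X\<bar> * K)"
  proof (rule order_trans[OF sum_abs sum_mono])
    fix X assume "X \<in> Pow ?S"
    then have "finite X" "X \<subseteq> ?S"
      using S by (auto intro: finite_subset)
    \<comment> \<open>Every site of \<open>A\<close> either stays or sends its partner into the new
      set, so that set is nonempty and the bound \<open>K\<close> applies.\<close>
    then have "finite (?B X)" "?B X \<noteq> {}"
      using A S by auto
    then show "\<bar>?c X * integral\<^sup>L N (character (?B X))\<bar> \<le> \<bar>?c X\<bar> * K"
      unfolding abs_mult[of "?c X"] by (intro mult_left_mono K) auto
  qed
  also have "\<dots> = (\<Sum>X\<in>Pow ?S. (\<Prod>i\<in>X. \<bar>r - p\<bar>) * (\<Prod>i\<in>?S - X. \<bar>r + p - 1\<bar>)) * K"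
    by (simp add: sum_distrib_right abs_mult power_abs)
  also have "\<dots> = (\<bar>r - p\<bar> + \<bar>r + p - 1\<bar>) ^ card ?S * K"
    by (subst prod_add[OF S(1), symmetric]) simp
  finally show ?thesis .
qed

lemma lonely_alternates:
  assumes "finite A" "A \<noteq> {}" and "lonely (Suc t) A = {}"
  shows "lonely t A \<noteq> {}"
proof -
  have M: "Max A \<in> A" "\<And>i. i \<in> A \<Longrightarrow> i \<le> Max A"
    using assms by auto
  with assms(3) have "partner (Suc t) (Max A) \<in> A"
    by (auto simp: lonely_def)
  \<comment> \<open>The partner at time \<open>Suc t\<close> lies in \<open>A\<close>, hence to the
    left of the maximum. Cells change parity at each step, so at time \<open>t\<close> the maximum
    is a left end and its partner falls outside \<open>A\<close>.\<close>
  then have "Max A \<in> cells t"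
    using M(2)[of "Max A + 1"] by (auto simp: partner_def split: if_splits)
  then have "partner t (Max A) \<notin> A"
    using M(2)[of "Max A + 1"] by (auto simp: partner_def)
  with M show ?thesis
    by (auto simp: lonely_def)
qed

section \<open>The law of a single line and its recursion\<close>

lemma measurable_history_component:
  "(n :: nat) < k \<Longrightarrow> (\<lambda>\<omega>. \<omega> n) \<in> PiM {0..<k} (\<lambda>_. line_space) \<rightarrow>\<^sub>M line_space"
  by (rule measurable_component_singleton) auto

definition line_law :: "(int \<Rightarrow> bool) measure \<Rightarrow> real \<Rightarrow> real \<Rightarrow> nat \<Rightarrow> (int \<Rightarrow> bool) measure" where
  "line_law \<mu> p r t = distr (chain_law \<mu> p r) line_space (\<lambda>\<omega>. \<omega> t)"

lemma sets_line_law: "sets (line_law \<mu> p r t) = sets line_space"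
  by (simp add: line_law_def)

context
  fixes \<mu> :: "(int \<Rightarrow> bool) measure" and p r :: real
  assumes \<mu>: "prob_space \<mu>" "sets \<mu> = sets line_space"
begin

interpretation Ionescu_Tulcea "line_kernel \<mu> p r" "\<lambda>_. line_space"
  by (rule Ionescu_Tulcea_line_kernel[OF \<mu>])

lemma sets_chain_law: "sets (chain_law \<mu> p r) = sets (PiM UNIV (\<lambda>_. line_space))"
  by (simp add: chain_law_def)

lemma line_law_eq_C:
  "line_law \<mu> p r t = distr (C 0 (Suc t) (\<lambda>_. undefined)) line_space (\<lambda>\<omega>. \<omega> t)"
proof -
  have [simp]: "(\<lambda>\<omega>. \<omega> t) \<in> PiM {t} (\<lambda>_. line_space) \<rightarrow>\<^sub>M line_space"
    by (rule measurable_component_singleton) simp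
  have "line_law \<mu> p r t
      = distr (distr PF.lim (PiM {t} (\<lambda>_. line_space)) (\<lambda>x. restrict x {t})) line_space (\<lambda>\<omega>. \<omega> t)"
    unfolding line_law_def chain_law_def
    by (subst distr_distr)
       (auto simp: measurable_cong_sets[OF PF.sets_lim refl] comp_def
         intro!: measurable_restrict_subset)
  also have "\<dots> = distr (CI {t}) line_space (\<lambda>\<omega>. \<omega> t)"
    by (simp add: distr_lim)
  \<comment> \<open>\<open>up_to\<close> is an exclusive bound on the indices, hence the
    successor.\<close>
  also have "up_to {t} = Suc t"
    by (intro antisym) (auto simp: up_to_iff Suc_le_eq up_to_less)
  then have "distr (CI {t}) line_space (\<lambda>\<omega>. \<omega> t)
      = distr (C 0 (Suc t) (\<lambda>_. undefined)) line_space (\<lambda>\<omega>. \<omega> t)"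
    unfolding CI_def using measurable_restrict_subset[of "{t}" "{0..<Suc t}"]
    by (subst distr_distr) (auto simp: measurable_cong_sets[OF sets_C refl] comp_def simp del: C.simps)
  finally show ?thesis .
qed

lemma prob_space_line_law: "prob_space (line_law \<mu> p r t)"
  unfolding line_law_eq_C
  by (intro prob_space.prob_space_distr prob_space_C)
     (auto simp: measurable_cong_sets[OF sets_C refl] simp del: C.simps
       intro: measurable_component_singleton)

text \<open>\<open>eP (Suc t)\<close> appends one line to the history. Projecting to that line
  leaves the kernel, which sees the history only through line \<open>t\<close>: this is the Markov
  property.\<close>

lemma line_law_Suc: "line_law \<mu> p r (Suc t) = line_law \<mu> p r t \<bind> step_kernel p r t"
proof -
  let ?C = "C 0 (Suc t) (\<lambda>_. undefined)"
  have sets_C': "sets ?C = sets (PiM {0..<Suc t} (\<lambda>_. line_space))"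
    using sets_C[of "\<lambda>_. undefined" 0 "Suc t"] by simp
  have ne: "space ?C \<noteq> {}"
    by (intro prob_space.not_empty prob_space_C) simp
  have eP: "eP (Suc t) \<in> ?C \<rightarrow>\<^sub>M subprob_algebra (PiM {0..<Suc (Suc t)} (\<lambda>_. line_space))"
    unfolding measurable_cong_sets[OF sets_C' refl] by (rule measurable_eP)
  have last: "(\<lambda>\<omega>. \<omega> t) \<in> ?C \<rightarrow>\<^sub>M line_space"
    unfolding measurable_cong_sets[OF sets_C' refl] by (intro measurable_history_component) simp
  have "line_law \<mu> p r (Suc t) = distr (?C \<bind> eP (Suc t)) line_space (\<lambda>\<omega>. \<omega> (Suc t))"
    unfolding line_law_eq_C by simp
  also have "\<dots> = ?C \<bind> (\<lambda>\<omega>. distr (eP (Suc t) \<omega>) line_space (\<lambda>\<omega>. \<omega> (Suc t)))"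
    by (intro distr_bind[OF eP ne] measurable_history_component) simp
  also have "\<dots> = ?C \<bind> (\<lambda>\<omega>. step_kernel p r t (\<omega> t))"
  proof (rule bind_cong[OF refl])
    fix \<omega> assume "\<omega> \<in> space ?C"
    then have \<omega>: "\<omega> \<in> space (PiM {0..<Suc t} (\<lambda>_. line_space))"
      using sets_eq_imp_space_eq[OF sets_C'] by simp
    have upd: "fun_upd \<omega> (Suc t) \<in> line_kernel \<mu> p r (Suc t) \<omega> \<rightarrow>\<^sub>M PiM {0..<Suc (Suc t)} (\<lambda>_. line_space)"
      unfolding measurable_cong_sets[OF sets_P[OF \<omega>] refl]
      by (rule measurable_fun_upd[where J="{0..<Suc t}"]) (use \<omega> in auto)
    \<comment> \<open>Reading the index that was just updated returns the fresh sample.\<close>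
    have "distr (eP (Suc t) \<omega>) line_space (\<lambda>\<omega>. \<omega> (Suc t))
        = distr (line_kernel \<mu> p r (Suc t) \<omega>) line_space (\<lambda>x. x)"
      unfolding eP_def
      by (subst distr_distr[OF _ upd])
         (auto simp: comp_def intro: measurable_history_component)
    also have "\<dots> = line_kernel \<mu> p r (Suc t) \<omega>"
      by (rule distr_id2) (simp only: sets_P[OF \<omega>])
    finally show "distr (eP (Suc t) \<omega>) line_space (\<lambda>\<omega>. \<omega> (Suc t)) = step_kernel p r t (\<omega> t)"
      by simp
  qed
  also have "\<dots> = distr ?C line_space (\<lambda>\<omega>. \<omega> t) \<bind> step_kernel p r t"
    by (rule bind_distr[symmetric, OF last measurable_prob_algebraD[OF measurable_step_kernel] ne])
  finally show ?thesis
    unfolding line_law_eq_C .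
qed

end

section \<open>Exponential decay of the mean of a character\<close>

lemma abs_integral_character_line_law_le:
  assumes \<mu>: "prob_space \<mu>" "sets \<mu> = sets line_space"
    and pr: "0 \<le> p" "p \<le> 1" "0 \<le> r" "r \<le> 1"
    and A: "finite A" "A \<noteq> {}"
    and \<rho>: "\<rho> = \<bar>r - p\<bar> + \<bar>r + p - 1\<bar>"
  shows "\<bar>integral\<^sup>L (line_law \<mu> p r t) (character A)\<bar> \<le> \<rho> ^ (t div 2)"
  using A
\<comment> \<open>The induction is strong because it goes back one or two steps, and it covers all
  \<open>A\<close> at once because a step replaces \<open>A\<close> by other sets.\<close>
proof (induction t arbitrary: A rule: less_induct)
  case (less t)
  have \<rho>01: "0 \<le> \<rho>" "\<rho> \<le> 1"
    using pr by (auto simp: \<rho>)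
  note prob = prob_space_line_law[OF \<mu>, of p r]
  have step: "integral\<^sup>L (line_law \<mu> p r (Suc s)) (character B)
      = (\<integral>x. (\<Prod>i\<in>B. site_factor p r s B x i) \<partial>line_law \<mu> p r s)" if "finite B" for s B
  proof -
    interpret prob_space "line_law \<mu> p r s" by (rule prob)
    have kernel: "step_kernel p r s \<in> line_law \<mu> p r s \<rightarrow>\<^sub>M prob_algebra line_space"
      unfolding measurable_cong_sets[OF sets_line_law refl] by (rule measurable_step_kernel)
    have "integral\<^sup>L (line_law \<mu> p r s \<bind> step_kernel p r s) (character B)
        = (\<integral>x. integral\<^sup>L (step_kernel p r s x) (character B) \<partial>line_law \<mu> p r s)"
    \<comment> \<open>\<open>B\<close> bounds the character and \<open>B'\<close> the total mass of
      the kernels.\<close>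
    proof (rule integral_bind[where B = 1 and B' = 1])
      show "AE x in line_law \<mu> p r s. emeasure (step_kernel p r s x) (space (step_kernel p r s x)) \<le> ennreal 1"
        using measurable_space[OF kernel]
        by (auto simp: space_prob_algebra prob_space.emeasure_space_1)
    qed (use measurable_prob_algebraD[OF kernel] in \<open>auto intro: finite_measure_axioms\<close>)
    then show ?thesis
      by (simp add: line_law_Suc[OF \<mu>] integral_character_step_kernel[OF pr that])
  qed
  have gain: "\<bar>integral\<^sup>L (line_law \<mu> p r (Suc s)) (character A)\<bar> \<le> \<rho> * \<rho> ^ (s div 2)"
    if "s < t" "lonely s A \<noteq> {}" for s
  proof -
    have "\<bar>integral\<^sup>L (line_law \<mu> p r (Suc s)) (character A)\<bar>
        \<le> \<rho> ^ card (lonely s A) * \<rho> ^ (s div 2)"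
      unfolding step[OF less.prems(1)] \<rho>
      by (rule abs_integral_prod_site_factor_le[OF prob sets_line_law less.prems])
         (use less.IH[OF \<open>s < t\<close>] in \<open>auto simp: \<rho>\<close>)
    also have "finite (lonely s A)"
      using less.prems by (simp add: lonely_def)
    then have "card (lonely s A) \<ge> 1"
      using that(2) by (simp add: Suc_le_eq card_gt_0_iff)
    then have "\<rho> ^ card (lonely s A) * \<rho> ^ (s div 2) \<le> \<rho> ^ 1 * \<rho> ^ (s div 2)"
      using \<rho>01 by (intro mult_right_mono power_decreasing) auto
    finally show ?thesis by simp
  qed
  show ?case
  proof (cases "t < 2")
    case True
    interpret prob_space "line_law \<mu> p r t" by (rule prob)
    have "\<bar>integral\<^sup>L (line_law \<mu> p r t) (character A)\<bar> \<le> (\<integral>x. \<bar>character A x\<bar> \<partial>line_law \<mu> p r t)"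
      by (rule integral_abs_bound)
    with True show ?thesis
      by (simp add: prob_space)
  next
    case False
    then obtain s where t: "t = Suc (Suc s)"
      by (metis One_nat_def Suc_1 less_2_cases_iff not0_implies_Suc)
    show ?thesis
    proof (cases "lonely (Suc s) A = {}")
      case True
      \<comment> \<open>Here \<open>A\<close> is a union of cells, so the last step leaves the mean
        unchanged and the factor \<open>\<rho>\<close> comes from the step before.\<close>
      have "integral\<^sup>L (line_law \<mu> p r t) (character A) = integral\<^sup>L (line_law \<mu> p r (Suc s)) (character A)"
        unfolding t step[OF less.prems(1), of "Suc s"]
        by (simp add: prod_site_factor[OF less.prems(1)] True)
      with gain[of s] lonely_alternates[OF less.prems True] show ?thesis
        by (simp add: t)
    next
      case False
      have "\<bar>integral\<^sup>L (line_law \<mu> p r t) (character A)\<bar> \<le> \<rho> * \<rho> ^ (Suc s div 2)"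
        using gain[of "Suc s"] False by (simp add: t)
      \<comment> \<open>The exponent on the left is \<open>Suc (Suc s div 2)\<close>, which is at
        least \<open>t div 2\<close>.\<close>
      also have "\<dots> \<le> \<rho> ^ (t div 2)"
        using \<rho>01 unfolding t power_Suc[symmetric] by (intro power_decreasing) auto
      finally show ?thesis .
    qed
  qed
qed

section \<open>Convergence of the lines of the field\<close>

theorem proposition1p6:
  fixes \<mu> :: "(int \<Rightarrow> bool) measure"
    and p r :: real
    and M :: "'w measure"
    and e :: "'w \<Rightarrow> int \<times> nat \<Rightarrow> bool"
  assumes "prob_space \<mu>"
    and "sets \<mu> = sets line_space"
    and "0 < p" "p < 1" "0 < r" "r < 1"
    and "prob_space M"
    and "e \<in> M \<rightarrow>\<^sub>M field_space"
    and "distr M field_space e = field_law \<mu> p r"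
  shows "weakly_converges (\<lambda>t. distr M line_space (\<lambda>\<omega> i. e \<omega> (i, t))) PM_half"
proof -
  note \<mu> = assms(1,2)
  \<comment> \<open>The law of a row depends only on the law of the field, and extracting row
    \<open>t\<close> undoes the reindexing in \<open>field_law\<close>.\<close>
  have marginal: "distr M line_space (\<lambda>\<omega> i. e \<omega> (i, t)) = line_law \<mu> p r t" for t
  proof -
    have row: "(\<lambda>w i. w (i, t)) \<in> field_space \<rightarrow>\<^sub>M line_space"
      by (rule measurable_PiM_single') (auto intro: measurable_component_singleton simp: space_PiM)
    have field: "(\<lambda>\<omega> (i, t). \<omega> t i) \<in> chain_law \<mu> p r \<rightarrow>\<^sub>M field_space"
      unfolding measurable_cong_sets[OF sets_chain_law[OF \<mu>] refl]
    proof (rule measurable_PiM_single')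
      fix it :: "int \<times> nat"
      obtain i t where it: "it = (i, t)" by (cases it)
      have "(\<lambda>\<omega>. \<omega> t) \<in> PiM UNIV (\<lambda>_. line_space) \<rightarrow>\<^sub>M line_space"
        by (rule measurable_component_singleton) simp
      then show "(\<lambda>\<omega>. case it of (i, t) \<Rightarrow> \<omega> t i) \<in> PiM UNIV (\<lambda>_. line_space) \<rightarrow>\<^sub>M count_space UNIV"
        unfolding it prod.case by (rule measurable_compose) (rule measurable_component_singleton, simp)
    qed (simp add: space_PiM)
    have "distr M line_space (\<lambda>\<omega> i. e \<omega> (i, t))
        = distr (distr M field_space e) line_space (\<lambda>w i. w (i, t))"
      by (subst distr_distr[OF row assms(8)]) (simp add: comp_def)
    also have "\<dots> = line_law \<mu> p r t"
      unfolding assms(9) field_law_def line_law_def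
      by (subst distr_distr[OF row field]) (simp add: comp_def)
    finally show ?thesis .
  qed
  \<comment> \<open>This is the maximum of \<open>\<bar>2 * r - 1\<bar>\<close> and
    \<open>\<bar>2 * p - 1\<bar>\<close>, hence below 1 for parameters inside the open
    square.\<close>
  define \<rho> where "\<rho> = \<bar>r - p\<bar> + \<bar>r + p - 1\<bar>"
  have "0 \<le> \<rho>" "\<rho> < 1"
    using assms(3-6) by (auto simp: \<rho>_def)
  then have "(\<lambda>n. \<rho> ^ n) \<longlonglongrightarrow> 0"
    by (rule LIMSEQ_realpow_zero)
  moreover have "filterlim (\<lambda>t :: nat. t div 2) at_top sequentially"
    unfolding filterlim_at_top
  proof
    show "\<forall>\<^sub>F t :: nat in sequentially. Z \<le> t div 2" for Z
      by (rule eventually_sequentiallyI[of "2 * Z"]) simp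
  qed
  ultimately have \<rho>_half: "(\<lambda>t. \<rho> ^ (t div 2)) \<longlonglongrightarrow> 0"
    by (rule filterlim_compose)
  show ?thesis
    unfolding marginal
  proof (rule weakly_converges_characters)
    fix A :: "int set" assume A: "finite A"
    show "(\<lambda>t. integral\<^sup>L (line_law \<mu> p r t) (character A)) \<longlonglongrightarrow> integral\<^sup>L PM_half (character A)"
    proof (cases "A = {}")
      case True
      then show ?thesis
        using prob_space.prob_space[OF prob_space_line_law[OF \<mu>]] prob_space.prob_space[OF prob_space_PM_half]
        by simp
    next
      case False
      have "(\<lambda>t. integral\<^sup>L (line_law \<mu> p r t) (character A)) \<longlonglongrightarrow> 0"
        using abs_integral_character_line_law_le[OF \<mu> _ _ _ _ A False \<rho>_def] assms(3-6)
        by (intro Lim_null_comparison[OF _ \<rho>_half] always_eventually) auto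
      then show ?thesis
        by (simp add: integral_character_PM_half[OF A False])
    qed
  qed (auto simp: prob_space_line_law[OF \<mu>] prob_space_PM_half sets_PM_half sets_line_law)
qed

end
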